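(* Let $h \geq 2$ be an integer, and let $A$ be an infinite set of nonnegative integers. If $r_{A,h}(n) \geq 2$ for all sufficiently large integers $n \in hA$, then there is a positive number $w_0$ such that \[ A(x) > \frac{\log x}{\log h} - w_0 \] for all $x \geq h$.
   Context: For a set $A$ of integers, the counting function $A(x)$ is the number of positive integers $a \in A$ with $a \leq x$. For an integer $h \geq 1$, the $h$-fold sumset $hA$ is the set of all integers that can be written as a sum of $h$ not necessarily distinct elements of $A$. For every integer $n$, the representation function $r_{A,h}(n)$ is the number of $h$-tuples $(a_1,\ldots,a_h) \in A^h$ with $a_1 \leq a_2 \leq \cdots \leq a_h$ and $a_1 + \cdots + a_h = n$. *)

theory Defs
  imports Complex_Main
begin

text \<open>Only positive elements are counted, so \<open>0 \<in> A\<close> does not contribute.\<close>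
definition counting_fun :: "int set \<Rightarrow> real \<Rightarrow> nat" where
  "counting_fun A x = card {a \<in> A. 0 < a \<and> real_of_int a \<le> x}"

definition hfold_sumset :: "nat \<Rightarrow> int set \<Rightarrow> int set" where
  "hfold_sumset h A = {sum_list as | as. length as = h \<and> set as \<subseteq> A}"

text \<open>An \<open>h\<close>-tuple is a list of length \<open>h\<close>; \<open>sorted\<close> is the non-strict order.
  Since \<open>card\<close> of an infinite set is \<open>0\<close>, the value is only meaningful when \<open>n\<close> has
  finitely many representations, as is the case whenever \<open>A\<close> is bounded below.\<close>
definition rep_fun :: "int set \<Rightarrow> nat \<Rightarrow> int \<Rightarrow> nat" where
  "rep_fun A h n = card {as. length as = h \<and> set as \<subseteq> A \<and> sorted as \<and> sum_list as = n}"

end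

(* If a is a large element of A, then h*a = a + ... + a has a second representation, whose
   largest summand b satisfies a < b \<le> h*a.  Iterating, A contains k + 1 elements
   in the interval from a to a * h^k for every k, which is the logarithmic lower bound. *)
theory Submission
  imports Defs
begin

lemma sum_list_le_length_mult:
  fixes as :: "int list"
  assumes "\<forall>x\<in>set as. x \<le> a"
  shows "sum_list as \<le> int (length as) * a"
  using assms by (induction as) (auto simp: algebra_simps)

text \<open>Equality case of the preceding bound: a head smaller than \<open>a\<close> would force
  the tail to sum to more than its length times \<open>a\<close>.\<close>

lemma sum_list_eq_length_mult_imp_replicate:
  fixes as :: "int list"
  assumes "\<forall>x\<in>set as. x \<le> a" and "sum_list as = int (length as) * a"
  shows "as = replicate (length as) a"
  using assms
proof (induction as)
  case (Cons x xs)
  have "sum_list xs \<le> int (length xs) * a"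
    using Cons.prems by (intro sum_list_le_length_mult) auto
  with Cons.prems have "x = a" "sum_list xs = int (length xs) * a"
    by (auto simp: algebra_simps)
  with Cons show ?case by auto
qed simp

lemma member_le_sum_list_nonneg:
  fixes as :: "int list"
  assumes "\<forall>y\<in>set as. 0 \<le> y" and "x \<in> set as"
  shows "x \<le> sum_list as"
  using assms
proof (induction as)
  case (Cons y ys)
  have "0 \<le> sum_list ys"
    using Cons.prems by (intro sum_list_nonneg) auto
  with Cons show ?case by fastforce
qed simp

text \<open>The constant tuple accounts for only one representation of \<open>int h * a\<close>. By
  the equality case above, any other one has an entry exceeding \<open>a\<close>, and nonnegativity
  of the remaining entries keeps that entry at most the total.\<close>

lemma ex_larger_element:
  assumes nonneg: "\<forall>a\<in>A. 0 \<le> a" and rep: "rep_fun A h (int h * a) \<ge> 2"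
  shows "\<exists>b\<in>A. a < b \<and> b \<le> int h * a"
proof -
  define T where
    "T = {as. length as = h \<and> set as \<subseteq> A \<and> sorted as \<and> sum_list as = int h * a}"
  have "card T \<ge> 2"
    using rep by (simp add: rep_fun_def T_def)
  then have "\<not> T \<subseteq> {replicate h a}"
    using card_mono[of "{replicate h a}" T] by auto
  then obtain as where as: "as \<in> T" "as \<noteq> replicate h a" by blast
  then obtain b where b: "b \<in> set as" "a < b"
    using sum_list_eq_length_mult_imp_replicate[of as a] by (force simp: T_def)
  have "b \<le> sum_list as"
    using as(1) b(1) nonneg by (intro member_le_sum_list_nonneg) (auto simp: T_def)
  with as(1) b show ?thesis by (auto simp: T_def)
qed

text \<open>Induction on \<open>k\<close>: each application of \<open>step\<close> contributes one
  new element and costs one factor \<open>h\<close> in the upper bound.\<close>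

lemma ex_geometric_subset:
  fixes h :: nat and A :: "int set"
  assumes step: "\<And>a. a \<in> A \<Longrightarrow> a\<^sub>0 \<le> a \<Longrightarrow> \<exists>b\<in>A. a < b \<and> b \<le> int h * a"
    and "a\<^sub>0 \<in> A" and "0 < a\<^sub>0"
  shows "\<exists>S\<subseteq>A. finite S \<and> card S = Suc k \<and> (\<forall>s\<in>S. a\<^sub>0 \<le> s \<and> s \<le> a\<^sub>0 * int h ^ k)"
proof (induction k)
  case 0
  show ?case using assms by (intro exI[of _ "{a\<^sub>0}"]) auto
next
  case (Suc k)
  then obtain S where S: "S \<subseteq> A" "finite S" "card S = Suc k"
    "\<forall>s\<in>S. a\<^sub>0 \<le> s \<and> s \<le> a\<^sub>0 * int h ^ k" by blast
  then have "S \<noteq> {}" by auto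
  \<comment> \<open>Applying \<open>step\<close> to the maximum guarantees that the element obtained
    lies outside \<open>S\<close>.\<close>
  define m where "m = Max S"
  have m: "m \<in> S" "\<forall>s\<in>S. s \<le> m"
    using S(2) \<open>S \<noteq> {}\<close> by (auto simp: m_def)
  then obtain b where b: "b \<in> A" "m < b" "b \<le> int h * m"
    using step S by blast
  have "int h * m \<le> int h * (a\<^sub>0 * int h ^ k)"
    using S(4) m(1) by (intro mult_left_mono) auto
  with b(3) have b_le: "b \<le> a\<^sub>0 * int h ^ Suc k" by (simp add: algebra_simps)
  have "b \<notin> S" using m b by force
  moreover have "a\<^sub>0 \<le> b" using S(4) m(1) b(2) by force
  moreover have "s \<le> a\<^sub>0 * int h ^ Suc k" if "s \<in> S" for s
    using that m(2) b(2) b_le by force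
  ultimately show ?case
    using S b b_le by (intro exI[of _ "insert b S"]) auto
qed

text \<open>Monotonicity of \<open>card\<close> requires the larger set to be finite; here it lies
  between 0 and the floor of \<open>x\<close>.\<close>

lemma card_le_counting_fun:
  assumes "S \<subseteq> A" and "\<forall>s\<in>S. 0 < s \<and> real_of_int s \<le> x"
  shows "card S \<le> counting_fun A x"
  unfolding counting_fun_def
proof (rule card_mono)
  have "{a \<in> A. 0 < a \<and> real_of_int a \<le> x} \<subseteq> {0..\<lfloor>x\<rfloor>}"
    by (auto simp: le_floor_iff)
  then show "finite {a \<in> A. 0 < a \<and> real_of_int a \<le> x}"
    by (rule finite_subset) simp
qed (use assms in auto)

theorem theorem1:
  fixes h :: nat and A :: "int set"
  assumes "h \<ge> 2"
    and "infinite A"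
    and "\<forall>a\<in>A. 0 \<le> a"
    and "\<exists>N::int. \<forall>n\<in>hfold_sumset h A. n \<ge> N \<longrightarrow> rep_fun A h n \<ge> 2"
  shows "\<exists>w\<^sub>0::real. w\<^sub>0 > 0 \<and>
    (\<forall>x::real. x \<ge> real h \<longrightarrow> real (counting_fun A x) > ln x / ln (real h) - w\<^sub>0)"
proof -
  obtain N where N: "\<And>n. n \<in> hfold_sumset h A \<Longrightarrow> n \<ge> N \<Longrightarrow> rep_fun A h n \<ge> 2"
    using assms(4) by blast
  \<comment> \<open>The chain starts beyond \<open>N\<close>, so that \<open>int h * a\<close> is
    past the threshold for every later \<open>a\<close>, and beyond 1, so that the constant
    \<open>w\<close> below is positive.\<close>
  have "\<not> A \<subseteq> {0..max N 1}"
    using assms(2) finite_subset by blast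
  then obtain a\<^sub>0 where a\<^sub>0: "a\<^sub>0 \<in> A" "N < a\<^sub>0" "1 < a\<^sub>0"
    using assms(3) by fastforce
  have step: "\<exists>b\<in>A. a < b \<and> b \<le> int h * a" if "a \<in> A" "a\<^sub>0 \<le> a" for a
  proof (rule ex_larger_element[OF assms(3)], rule N)
    show "int h * a \<in> hfold_sumset h A"
      unfolding hfold_sumset_def using that(1)
      by (auto simp: sum_list_replicate intro!: exI[of _ "replicate h a"])
    have "1 * a \<le> int h * a"
      using assms(1) that(2) a\<^sub>0 by (intro mult_right_mono) auto
    then show "N \<le> int h * a"
      using that(2) a\<^sub>0 by linarith
  qed
  \<comment> \<open>This is the logarithm of \<open>a\<^sub>0\<close> to base \<open>h\<close>, the
    loss from starting the chain at \<open>a\<^sub>0\<close>.\<close>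
  define w where "w = ln (real_of_int a\<^sub>0) / ln (real h)"
  have ln_h: "ln (real h) > 0" using assms(1) by simp
  have w: "w > 0" unfolding w_def using a\<^sub>0 ln_h by simp
  have "real (counting_fun A x) > ln x / ln (real h) - w" if x: "x \<ge> real h" for x
  proof (cases "x < real_of_int a\<^sub>0")
    case True
    \<comment> \<open>Below \<open>a\<^sub>0\<close> the claimed lower bound is negative, while the
      count is at least 0.\<close>
    have "ln x < ln (real_of_int a\<^sub>0)"
      using True x assms(1) by (subst ln_less_cancel_iff) auto
    then have "ln x / ln (real h) < w"
      unfolding w_def using ln_h by (intro divide_strict_right_mono)
    then show ?thesis by linarith
  next
    case False
    define L where "L = log (real h) (x / real_of_int a\<^sub>0)"
    have x_pos: "0 < x" using x assms(1) by linarith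
    have L: "L = ln x / ln (real h) - w"
      unfolding L_def w_def log_def using x_pos a\<^sub>0 by (simp add: ln_div diff_divide_distrib)
    have "L \<ge> 0"
      unfolding L_def using False a\<^sub>0 assms(1) by (intro zero_le_log_cancel_iff[THEN iffD2]) auto
    \<comment> \<open>The largest \<open>k\<close> for which \<open>a\<^sub>0 * h ^ k\<close> does
      not exceed \<open>x\<close>. The chain then has \<open>Suc k\<close> elements up to
      \<open>x\<close>, and \<open>L < Suc k\<close> makes the final inequality strict.\<close>
    define k where "k = nat \<lfloor>L\<rfloor>"
    have k: "real k \<le> L" "L < real (Suc k)"
      unfolding k_def using \<open>L \<ge> 0\<close> by linarith+
    have "real h ^ k \<le> real h powr L"
      using k(1) assms(1) by (simp flip: powr_realpow)
    also have "\<dots> = x / real_of_int a\<^sub>0"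
      unfolding L_def using x_pos a\<^sub>0 assms(1) by simp
    finally have hk: "real_of_int a\<^sub>0 * real h ^ k \<le> x"
      using a\<^sub>0 by (simp add: field_simps)
    obtain S where S: "S \<subseteq> A" "card S = Suc k" "\<forall>s\<in>S. a\<^sub>0 \<le> s \<and> s \<le> a\<^sub>0 * int h ^ k"
      using ex_geometric_subset[OF step a\<^sub>0(1)] a\<^sub>0(3) by (metis less_trans zero_less_one)
    have "card S \<le> counting_fun A x"
    proof (rule card_le_counting_fun[OF S(1)], intro ballI conjI)
      fix s assume s: "s \<in> S"
      then show "0 < s" using S(3) a\<^sub>0(3) by force
      have "real_of_int s \<le> real_of_int (a\<^sub>0 * int h ^ k)"
        using S(3) s by (simp only: of_int_le_iff)
      with hk show "real_of_int s \<le> x" by simp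
    qed
    with S(2) k(2) L show ?thesis by linarith
  qed
  with w show ?thesis by blast
qed

end
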